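(* Let $I$ be a non-empty set and $\langle \alpha_i : i\in I\rangle$ a sequence of non-zero ordinals, with $\alpha_i=\gamma_i+n_i$ where $\gamma_i$ is a limit ordinal or $0$ and $n_i\in\omega$. Let $I_\alpha=\{i\in I:\alpha_i=\alpha\}$ for ordinals $\alpha$, and $J_\gamma=\{i\in I:\gamma_i=\gamma\}$ for $\gamma$ a limit ordinal or $0$. Then the poset $\bigcup_{i\in I}\alpha_i$ is not reversible if and only if at least one of the following holds: (A) there are $i\in I$ and an ordinal $\alpha\le\gamma_i$ such that $|I_\alpha|\ge\omega$; (B) there is $\gamma$, a limit ordinal or $0$, such that $|J_\gamma\setminus I_\gamma|\ge\omega$ and the sequence $\langle n_i:i\in J_\gamma\setminus I_\gamma\rangle$ is not a reversible sequence of natural numbers.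
   Context: A poset $\mathbb{P}$ is reversible iff every bijective order-preserving map $f:\mathbb{P}\to\mathbb{P}$ is an automorphism. The poset $\bigcup_{i\in I}\alpha_i$ is the disjoint union of pairwise disjoint well orders $\mathbb{L}_i\cong\alpha_i$, elements of distinct components being incomparable. With $\mathrm{Sur}(J)$, $\mathrm{Sym}(J)$ the sets of surjections and bijections $J\to J$, a sequence $\langle n_i:i\in J\rangle$ of positive integers is a reversible sequence of natural numbers iff there is no $f\in\mathrm{Sur}(J)\setminus\mathrm{Sym}(J)$ with $\sum_{i\in f^{-1}[\{j\}]}n_i=n_j$ for all $j\in J$. *)

theory Defs
  imports Main
begin

unbundle cardinal_syntax

text \<open>
  Ordinals are represented by well-order relations, equality of ordinals being isomorphism
  \<open>=o\<close> and comparison being \<open>\<le>o\<close>.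
\<close>

definition ord_sum :: "'a rel \<Rightarrow> 'b rel \<Rightarrow> ('a + 'b) rel" where
  "ord_sum r s =
     {(Inl x, Inl y) | x y. (x, y) \<in> r} \<union>
     {(Inr x, Inr y) | x y. (x, y) \<in> s} \<union>
     {(Inl x, Inr y) | x y. x \<in> Field r \<and> y \<in> Field s}"

text \<open>
  An ordinal is a limit ordinal or zero iff it is not a successor, that is, iff the
  well order has no greatest element.
\<close>

definition limit_or_zero :: "'a rel \<Rightarrow> bool" where
  "limit_or_zero r \<longleftrightarrow>
     Well_order r \<and> \<not> (\<exists>m \<in> Field r. \<forall>x \<in> Field r. (x, m) \<in> r)"

definition disjoint_union :: "'i set \<Rightarrow> ('i \<Rightarrow> 'a rel) \<Rightarrow> ('i \<times> 'a) rel" where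
  "disjoint_union I r = {((i, x), (i, y)) | i x y. i \<in> I \<and> (x, y) \<in> r i}"

text \<open>
  A partial order is given by its (reflexive) order relation; its underlying set is
  the field of the relation.
\<close>

definition order_preserving :: "'a rel \<Rightarrow> ('a \<Rightarrow> 'a) \<Rightarrow> bool" where
  "order_preserving P f \<longleftrightarrow>
     (\<forall>x \<in> Field P. \<forall>y \<in> Field P. (x, y) \<in> P \<longrightarrow> (f x, f y) \<in> P)"

definition order_automorphism :: "'a rel \<Rightarrow> ('a \<Rightarrow> 'a) \<Rightarrow> bool" where
  "order_automorphism P f \<longleftrightarrow>
     bij_betw f (Field P) (Field P) \<and>
     (\<forall>x \<in> Field P. \<forall>y \<in> Field P. (x, y) \<in> P \<longleftrightarrow> (f x, f y) \<in> P)"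

definition reversible :: "'a rel \<Rightarrow> bool" where
  "reversible P \<longleftrightarrow>
     (\<forall>f. bij_betw f (Field P) (Field P) \<and> order_preserving P f \<longrightarrow> order_automorphism P f)"

text \<open>
  Intended for sequences of positive integers.  A sum of infinitely many positive integers
  is never a natural number, whence the finiteness requirement on the fibres
  (\<^const>\<open>sum\<close> would return zero on an infinite set).
\<close>

definition reversible_sequence :: "'i set \<Rightarrow> ('i \<Rightarrow> nat) \<Rightarrow> bool" where
  "reversible_sequence J n \<longleftrightarrow>
     \<not> (\<exists>f. f ` J = J \<and> \<not> bij_betw f J J \<and>
           (\<forall>j \<in> J. finite {i \<in> J. f i = j} \<and> (\<Sum>i \<in> {i \<in> J. f i = j}. n i) = n j))"

definition same_ordinal :: "'i set \<Rightarrow> ('i \<Rightarrow> 'a rel) \<Rightarrow> 'a rel \<Rightarrow> 'i set" where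
  "same_ordinal I r \<beta> = {i \<in> I. r i =o \<beta>}"

lemma Field_ord_sum: "Field (ord_sum r s) = Inl ` Field r \<union> Inr ` Field s"
  by (auto simp: Field_def ord_sum_def Domain_iff Range_iff image_iff)

lemma Well_order_ord_sum:
  assumes r: "Well_order r" and s: "Well_order s"
  shows "Well_order (ord_sum r s)"
proof -
  have R: "Refl r" "trans r" "antisym r" "Total r" "wf (r - Id)"
    and S: "Refl s" "trans s" "antisym s" "Total s" "wf (s - Id)"
    using r s by (auto simp: order_on_defs)
  have "Refl (ord_sum r s)"
    using R(1) S(1) unfolding refl_on_def Field_ord_sum by (auto simp: ord_sum_def)
  moreover have "trans (ord_sum r s)"
    unfolding trans_def ord_sum_def
    by (auto intro: FieldI1 FieldI2 dest: transD[OF R(2)] transD[OF S(2)])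
  moreover have "antisym (ord_sum r s)"
    unfolding antisym_def ord_sum_def by (auto dest: antisymD[OF R(3)] antisymD[OF S(3)])
  moreover have "Total (ord_sum r s)"
    using R(4) S(4) unfolding total_on_def Field_ord_sum unfolding ord_sum_def by blast
  moreover have "wf (ord_sum r s - Id)"
    unfolding wf_eq_minimal
  proof (intro allI impI)
    fix Q :: "('a + 'b) set" and x assume x: "x \<in> Q"
    show "\<exists>z \<in> Q. \<forall>y. (y, z) \<in> ord_sum r s - Id \<longrightarrow> y \<notin> Q"
    proof (cases "\<exists>a. Inl a \<in> Q")
      case True
      then obtain a where "a \<in> {a. Inl a \<in> Q}" by blast
      from wfE_min[OF R(5) this] obtain z where
        "Inl z \<in> Q" "\<And>y. (y, z) \<in> r - Id \<Longrightarrow> Inl y \<notin> Q" by auto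
      then show ?thesis by (intro bexI[of _ "Inl z"]) (auto simp: ord_sum_def)
    next
      case False
      with x obtain b where "b \<in> {b. Inr b \<in> Q}" by (cases x) auto
      from wfE_min[OF S(5) this] obtain z where
        "Inr z \<in> Q" "\<And>y. (y, z) \<in> s - Id \<Longrightarrow> Inr y \<notin> Q" by auto
      with False show ?thesis by (intro bexI[of _ "Inr z"]) (auto simp: ord_sum_def)
    qed
  qed
  moreover have "ord_sum r s \<subseteq> Field (ord_sum r s) \<times> Field (ord_sum r s)"
    by (meson FieldI1 FieldI2 mem_Sigma_iff subrelI)
  ultimately show ?thesis
    by (simp add: order_on_defs)
qed

lemma Field_disjoint_union: "Field (disjoint_union I r) = Sigma I (\<lambda>i. Field (r i))"
  by (auto simp: Field_def disjoint_union_def Domain_iff Range_iff)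

lemma Partial_order_disjoint_union:
  assumes "\<And>i. i \<in> I \<Longrightarrow> Well_order (r i)"
  shows "Partial_order (disjoint_union I r)"
proof -
  have R: "Refl (r i)" "trans (r i)" "antisym (r i)" if "i \<in> I" for i
    using assms[OF that] by (auto simp: order_on_defs)
  have "Refl (disjoint_union I r)"
    using R(1) unfolding refl_on_def Field_disjoint_union by (auto simp: disjoint_union_def)
  moreover have "trans (disjoint_union I r)"
    unfolding trans_def disjoint_union_def by (auto dest: transD[OF R(2)])
  moreover have "antisym (disjoint_union I r)"
    unfolding antisym_def disjoint_union_def by (auto dest: antisymD[OF R(3)])
  moreover have "disjoint_union I r \<subseteq> Field (disjoint_union I r) \<times> Field (disjoint_union I r)"
    by (meson FieldI1 FieldI2 mem_Sigma_iff subrelI)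
  ultimately show ?thesis
    by (simp add: order_on_defs)
qed

end

theory Submission
  imports Defs
begin

text \<open>
  A well order is a chain, so a bijective monotone self-map of the union carries each component
  into a single component. It thus induces a surjection \<open>f\<close> of the index set, and it is an
  automorphism unless \<open>f\<close> identifies two indices. Hence the union is not reversible iff some
  non-injective surjection \<open>f\<close> of \<open>I\<close> admits, for every \<open>j\<close>, a bijective monotone map from the
  union of the \<open>\<alpha>\<^sub>i\<close> with \<open>f i = j\<close> onto \<open>\<alpha>\<^sub>j\<close>.

  Such maps come from the identity \<open>2 \<cdot> \<gamma> = \<gamma>\<close> for limit \<open>\<gamma>\<close>: two chains \<open>\<rho> + a\<close> and \<open>\<gamma> + b\<close> with
  \<open>\<rho> \<le> \<gamma>\<close> can be interleaved below the finite tails to give \<open>\<gamma> + (a + b)\<close>. Under (A) one absorbs a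
  copy of \<open>\<alpha>\<close> into \<open>\<alpha>\<^sub>i\<close> and shifts a sequence of further copies; under (B) one merges along the
  fibres of a surjection witnessing that the tail lengths are not a reversible sequence.

  Conversely \<open>\<alpha>\<^sub>i \<le> \<alpha>\<^bsub>f i\<^esub>\<close>. If (A) fails, induction on \<open>\<beta>\<close> shows that \<open>f\<close> permutes the finite set
  \<open>I\<^sub>\<beta>\<close> whenever \<open>\<beta>\<close> is at most some \<open>\<gamma>\<^sub>k\<close>. The remaining indices, those with \<open>\<alpha>\<^sub>i\<close> above all
  \<open>\<gamma>\<^sub>k\<close>, form exactly \<open>J\<^sub>\<gamma> - I\<^sub>\<gamma>\<close> for the greatest \<open>\<gamma>\<close>, and there the components of \<open>f\<close> map finite tails
  to finite tails, so the tail lengths add up along the fibres of \<open>f\<close>.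
\<close>

section \<open>Injective monotone maps between well orders\<close>

lemma Well_order_antisymD:
  "Well_order r \<Longrightarrow> (x, y) \<in> r \<Longrightarrow> (y, x) \<in> r \<Longrightarrow> x = y"
  by (auto simp: order_on_defs dest: antisymD)

lemma Well_order_reflD: "Well_order r \<Longrightarrow> x \<in> Field r \<Longrightarrow> (x, x) \<in> r"
  by (auto simp: order_on_defs refl_on_def)

lemma Well_order_linear:
  "Well_order r \<Longrightarrow> x \<in> Field r \<Longrightarrow> y \<in> Field r \<Longrightarrow> (x, y) \<in> r \<or> (y, x) \<in> r"
  by (cases "x = y") (auto simp: order_on_defs refl_on_def total_on_def)

lemma compat_in_Field: "compat r s f \<Longrightarrow> x \<in> Field r \<Longrightarrow> f x \<in> Field s"
  by (auto simp: compat_def Field_def)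

text \<open>At a least point \<open>z\<close> with \<open>f z\<close> strictly below
  \<open>z\<close>, monotonicity and injectivity put \<open>f (f z)\<close> strictly below
  \<open>f z\<close>. Then \<open>f z\<close> is a smaller point of the same kind.\<close>

lemma self_compat_inflationary:
  assumes r: "Well_order r" and f: "compat r r f" "inj_on f (Field r)" and a: "a \<in> Field r"
  shows "(a, f a) \<in> r"
proof (rule ccontr)
  let ?B = "{a \<in> Field r. (a, f a) \<notin> r}"
  assume "(a, f a) \<notin> r"
  with a have "a \<in> ?B" by simp
  moreover have "wf (r - Id)" using r by (auto simp: order_on_defs)
  ultimately obtain z where z: "z \<in> ?B" and min: "\<And>y. (y, z) \<in> r - Id \<Longrightarrow> y \<notin> ?B"
    by (metis (no_types, lifting) wfE_min)
  have fz: "f z \<in> Field r" "(f z, z) \<in> r" "f z \<noteq> z"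
    using z compat_in_Field[OF f(1)] Well_order_linear[OF r] Well_order_reflD[OF r] by force+
  then have "(f (f z), f z) \<in> r" using f(1) by (auto simp: compat_def)
  moreover have "f (f z) \<noteq> f z" using f(2) fz z by (auto dest: inj_onD)
  ultimately have "(f z, f (f z)) \<notin> r" using Well_order_antisymD[OF r] by blast
  with fz min[of "f z"] show False by auto
qed

text \<open>Monotone injections bound order types even when their images are not initial segments.
  If \<open>s <o r\<close>, then \<open>s\<close> is isomorphic to the segment of \<open>r\<close>
  below some \<open>a\<close>; following \<open>f\<close> by this isomorphism moves \<open>a\<close>
  strictly below itself, against \<open>self_compat_inflationary\<close>.\<close>

lemma compat_inj_imp_ordLeq:
  assumes r: "Well_order r" and s: "Well_order s"
    and f: "compat r s f" "inj_on f (Field r)"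
  shows "r \<le>o s"
proof (rule ccontr)
  assume "\<not> r \<le>o s"
  then have "s <o r" using r s not_ordLeq_iff_ordLess by blast
  then obtain a where a: "a \<in> Field r" and "s =o Restr r (underS r a)"
    using ordLess_iff_ordIso_Restr[OF r s] by blast
  then obtain h where iso: "iso s (Restr r (underS r a)) h" by (auto simp: ordIso_def)
  have h: "compat s (Restr r (underS r a)) h" "inj_on h (Field s)"
    unfolding compat_def using iso_forward[OF _ iso] iso_imp_inj_on[OF iso] by blast+
  have "compat r r (h \<circ> f)" using f h by (auto simp: compat_def)
  moreover have "inj_on (h \<circ> f) (Field r)"
    using f h compat_in_Field by (metis comp_inj_on image_subsetI inj_on_subset)
  ultimately have "(a, h (f a)) \<in> r" using self_compat_inflationary[OF r] a by fastforce
  moreover have "h (f a) \<in> underS r a"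
    using a compat_in_Field[OF h(1) compat_in_Field[OF f(1) a]] Field_Restr_subset by fast
  ultimately show False using Well_order_antisymD[OF r] by (auto simp: underS_def)
qed

lemma ordLeq_obtain_map:
  assumes "r \<le>o s"
  obtains f where "compat r s f" "inj_on f (Field r)"
  using assms by (auto simp: ordLeq_def intro: embed_compat embed_inj_on)

section \<open>Limit ordinals absorb doubling\<close>

text \<open>The ordinal product \<open>2 \<cdot> r\<close>: every point becomes a two-element chain,
  its \<open>False\<close> copy below its \<open>True\<close> copy. The two kinds of copies are the
  places for two chains that are to be interleaved.\<close>

definition dbl :: "'a rel \<Rightarrow> ('a \<times> bool) rel" where
  "dbl r = {((x, b), (y, c)). (x, y) \<in> r \<and> (x = y \<longrightarrow> b \<le> c)}"

lemma Field_dbl: "Well_order r \<Longrightarrow> Field (dbl r) = Field r \<times> UNIV"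
  by (auto simp: Field_def dbl_def dest: Well_order_reflD intro: FieldI1 FieldI2)

lemma Well_order_dbl:
  assumes r: "Well_order r"
  shows "Well_order (dbl r)"
proof -
  have R: "Refl r" "trans r" "antisym r" "Total r" "wf (r - Id)"
    using r by (auto simp: order_on_defs)
  have "Refl (dbl r)"
    unfolding refl_on_def Field_dbl[OF r] using R(1) by (auto simp: dbl_def refl_on_def)
  moreover have "trans (dbl r)"
  proof (rule transI)
    fix p q t assume "(p, q) \<in> dbl r" "(q, t) \<in> dbl r"
    then obtain x b y c z d where *: "p = (x, b)" "q = (y, c)" "t = (z, d)"
      "(x, y) \<in> r" "(y, z) \<in> r" "x = y \<longrightarrow> b \<le> c" "y = z \<longrightarrow> c \<le> d"
      by (auto simp: dbl_def)
    moreover have "(x, z) \<in> r" using transD[OF R(2)] *(4,5) .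
    moreover have "x = z \<Longrightarrow> x = y" using antisymD[OF R(3)] *(4,5) by blast
    ultimately show "(p, t) \<in> dbl r" by (auto simp: dbl_def)
  qed
  moreover have "antisym (dbl r)"
    by (rule antisymI) (auto simp: dbl_def dest: antisymD[OF R(3)])
  moreover have "Total (dbl r)"
    using Well_order_linear[OF r] unfolding total_on_def Field_dbl[OF r]
    by (auto simp: dbl_def dest: Well_order_reflD[OF r])
  moreover have "wf (dbl r - Id)"
  proof (rule wf_subset)
    show "wf ((r - Id) <*lex*> {(False, True)})"
      using R(5) by (intro wf_lex_prod) (auto simp: wf_def)
  qed (auto simp: dbl_def)
  moreover have "dbl r \<subseteq> Field (dbl r) \<times> Field (dbl r)"
    by (meson FieldI1 FieldI2 mem_Sigma_iff subrelI)
  ultimately show ?thesis by (simp add: order_on_defs)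
qed

lemma limit_or_zero_ordIso:
  assumes "limit_or_zero r" and "r =o s"
  shows "limit_or_zero s"
proof -
  obtain f where s: "Well_order s" and f: "iso r s f"
    using assms(2) by (auto simp: ordIso_def)
  show ?thesis
    unfolding limit_or_zero_def
  proof (intro conjI s notI)
    assume "\<exists>m \<in> Field s. \<forall>x \<in> Field s. (x, m) \<in> s"
    then obtain m where "m \<in> Field r" "\<forall>x \<in> Field r. (f x, f m) \<in> s"
      unfolding iso_Field[OF f, symmetric] by blast
    then show False using assms(1) f by (auto simp: limit_or_zero_def iso_iff2)
  qed
qed

text \<open>
  If \<open>r < 2 \<cdot> r\<close>, then \<open>r\<close> is isomorphic to an initial segment of \<open>2 \<cdot> r\<close>; having no greatest element,
  this segment is \<open>2 \<cdot> s\<close> for a limit \<open>s < r\<close>, to which the induction hypothesis applies.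
\<close>

lemma limit_dbl_ordLeq:
  assumes "limit_or_zero r"
  shows "dbl r \<le>o r"
  using assms
proof (induction r rule: wf_induct_rule[OF wf_ordLess])
  case (1 r)
  then have r: "Well_order r" by (simp add: limit_or_zero_def)
  show ?case
  proof (rule ccontr)
    assume "\<not> dbl r \<le>o r"
    then have "r <o dbl r" using r Well_order_dbl not_ordLeq_iff_ordLess by blast
    then obtain a where "a \<in> Field (dbl r)"
      and iso: "r =o Restr (dbl r) (underS (dbl r) a)"
      using ordLess_iff_ordIso_Restr[OF Well_order_dbl[OF r] r] by blast
    then obtain x b where a: "a = (x, b)" and x: "x \<in> Field r"
      using Field_dbl[OF r] by (cases a) auto
    have lim: "limit_or_zero (Restr (dbl r) (underS (dbl r) a))"
      using limit_or_zero_ordIso[OF "1.prems" iso] .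
    have F: "Field (Restr (dbl r) (underS (dbl r) a)) = underS (dbl r) a"
      using Well_order_dbl[OF r] by (intro Refl_Field_Restr2) (auto simp: order_on_defs underS_Field)
    \<comment> \<open>A segment cut off at a \<open>True\<close> copy would have the
      \<open>False\<close> copy of the same point as its greatest element. So the cut never splits a
      pair, and the segment is the double of a segment of \<open>r\<close>.\<close>
    have "\<not> b"
    proof
      assume b
      then have "(x, False) \<in> underS (dbl r) a"
        "\<forall>y \<in> underS (dbl r) a. (y, (x, False)) \<in> dbl r"
        using a x Well_order_reflD[OF r] by (auto simp: underS_def dbl_def)
      then show False using lim unfolding limit_or_zero_def F by blast
    qed
    define s where "s = Restr r (underS r x)"
    have s: "Well_order s" using r by (simp add: s_def Well_order_Restr)
    have less: "s <o r" using underS_Restr_ordLess[OF r, of x] x by (auto simp: s_def)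
    have eq: "Restr (dbl r) (underS (dbl r) a) = dbl s"
      using \<open>\<not> b\<close> by (auto simp: a s_def dbl_def underS_def)
    have "limit_or_zero s"
      unfolding limit_or_zero_def
    proof (intro conjI s notI)
      assume "\<exists>m \<in> Field s. \<forall>y \<in> Field s. (y, m) \<in> s"
      then obtain m where m: "m \<in> Field s" "\<forall>y \<in> Field s. (y, m) \<in> s" by blast
      then have "(m, True) \<in> Field (dbl s)" "\<forall>y \<in> Field (dbl s). (y, (m, True)) \<in> dbl s"
        unfolding Field_dbl[OF s] by (auto simp: dbl_def)
      then show False using lim unfolding eq limit_or_zero_def by blast
    qed
    then have "dbl s \<le>o s" using "1.IH" less by blast
    then have "r \<le>o s" using iso eq ordIso_ordLeq_trans by metis
    then show False using less not_ordLess_ordLeq by blast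
  qed
qed

section \<open>Condensations\<close>

text \<open>The inverse need not be monotone: up to renaming points, \<open>Q\<close> arises from
  \<open>P\<close> by adding relations. Every positive construction below produces such
  maps.\<close>

definition condenses :: "'a rel \<Rightarrow> 'b rel \<Rightarrow> bool" where
  "condenses P Q \<longleftrightarrow> (\<exists>f. bij_betw f (Field P) (Field Q) \<and> compat P Q f)"

text \<open>The binary counterpart of \<open>disjoint_union\<close>. The two carriers may have
  different types, so one component of a family can be split off and merged with the union of the
  rest.\<close>

definition psum :: "'a rel \<Rightarrow> 'b rel \<Rightarrow> ('a + 'b) rel" where
  "psum r s = {(Inl x, Inl y) | x y. (x, y) \<in> r} \<union> {(Inr x, Inr y) | x y. (x, y) \<in> s}"

lemma Field_psum: "Field (psum r s) = Inl ` Field r \<union> Inr ` Field s"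
  by (auto simp: Field_def psum_def Domain_iff Range_iff image_iff)

lemma condensesI: "bij_betw f (Field P) (Field Q) \<Longrightarrow> compat P Q f \<Longrightarrow> condenses P Q"
  by (auto simp: condenses_def)

lemma condenses_refl: "condenses P P"
  by (rule condensesI[of id]) (auto simp: compat_def)

lemma condenses_trans [trans]:
  assumes "condenses P Q" "condenses Q R"
  shows "condenses P R"
proof -
  obtain f g where "bij_betw f (Field P) (Field Q)" "compat P Q f"
    "bij_betw g (Field Q) (Field R)" "compat Q R g"
    using assms by (auto simp: condenses_def)
  then show ?thesis
    by (intro condensesI[of "g \<circ> f"]) (auto simp: compat_def intro: bij_betw_trans)
qed

lemma ordIso_condenses: "r =o s \<Longrightarrow> condenses r s"
  by (auto simp: ordIso_def iso_def condenses_def intro: embed_compat)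

lemma bij_betw_map_sum:
  assumes "bij_betw f A C" "bij_betw g B D"
  shows "bij_betw (map_sum f g) (Inl ` A \<union> Inr ` B) (Inl ` C \<union> Inr ` D)"
proof (rule bij_betw_imageI)
  show "inj_on (map_sum f g) (Inl ` A \<union> Inr ` B)"
    by (rule inj_onI)
       (auto dest: inj_onD[OF bij_betw_imp_inj_on[OF assms(1)]]
         inj_onD[OF bij_betw_imp_inj_on[OF assms(2)]])
  have "f ` A = C" "g ` B = D" using assms by (simp_all add: bij_betw_def)
  then show "map_sum f g ` (Inl ` A \<union> Inr ` B) = Inl ` C \<union> Inr ` D"
    by (auto simp: image_Un image_image)
qed

lemma condenses_psum:
  assumes "condenses r r'" "condenses s s'"
  shows "condenses (psum r s) (psum r' s')"
proof -
  obtain f g where "bij_betw f (Field r) (Field r')" "compat r r' f"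
    "bij_betw g (Field s) (Field s')" "compat s s' g"
    using assms by (auto simp: condenses_def)
  then show ?thesis
    by (intro condensesI[of "map_sum f g"])
       (auto simp: Field_psum bij_betw_map_sum, auto simp: compat_def psum_def)
qed

lemma condenses_ord_sum:
  assumes "condenses r r'" "condenses s s'"
  shows "condenses (ord_sum r s) (ord_sum r' s')"
proof -
  obtain f g where *: "bij_betw f (Field r) (Field r')" "compat r r' f"
    "bij_betw g (Field s) (Field s')" "compat s s' g"
    using assms by (auto simp: condenses_def)
  then have "compat (ord_sum r s) (ord_sum r' s') (map_sum f g)"
    using compat_in_Field[OF *(2)] compat_in_Field[OF *(4)]
    by (auto simp: ord_sum_def compat_def)
  with * show ?thesis
    by (intro condensesI[of "map_sum f g"]) (auto simp: Field_ord_sum bij_betw_map_sum)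
qed

text \<open>Regrouping keeps all relations inside the two chains and only adds new ones across them,
  such as \<open>r\<close> below \<open>q\<close> and \<open>s\<close> below
  \<open>p\<close>.\<close>

lemma condenses_psum_ord_sum:
  fixes r :: "'a rel" and p :: "'b rel" and s :: "'c rel" and q :: "'d rel"
  shows "condenses (psum (ord_sum r p) (ord_sum s q)) (ord_sum (psum r s) (psum p q))"
proof -
  define f :: "('a + 'b) + ('c + 'd) \<Rightarrow> ('a + 'c) + ('b + 'd)" where "f = (\<lambda>x. case x of
      Inl (Inl a) \<Rightarrow> Inl (Inl a) | Inl (Inr b) \<Rightarrow> Inr (Inl b)
    | Inr (Inl c) \<Rightarrow> Inl (Inr c) | Inr (Inr d) \<Rightarrow> Inr (Inr d))"
  show ?thesis
  proof (rule condensesI[of f])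
    show "bij_betw f (Field (psum (ord_sum r p) (ord_sum s q)))
      (Field (ord_sum (psum r s) (psum p q)))"
      unfolding Field_psum Field_ord_sum
      by (rule bij_betw_byWitness[where f' = "\<lambda>x. case x of
            Inl (Inl a) \<Rightarrow> Inl (Inl a) | Inl (Inr c) \<Rightarrow> Inr (Inl c)
          | Inr (Inl b) \<Rightarrow> Inl (Inr b) | Inr (Inr d) \<Rightarrow> Inr (Inr d)"])
         (auto simp: f_def)
    show "compat (psum (ord_sum r p) (ord_sum s q)) (ord_sum (psum r s) (psum p q)) f"
      unfolding compat_def ord_sum_def Field_psum by (auto simp: psum_def f_def)
  qed
qed

text \<open>Place \<open>r\<close> on \<open>False\<close> copies and \<open>s\<close> on the
  \<open>True\<close> copies of \<open>dbl s\<close>. The order induced on the occupied points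
  contains a copy of \<open>s\<close> and is at most \<open>dbl s\<close>, which is at most
  \<open>s\<close> because \<open>s\<close> is a limit or zero. Hence it is isomorphic to
  \<open>s\<close>.\<close>

lemma condenses_psum_limit:
  assumes lim: "limit_or_zero s" and le: "r \<le>o s"
  shows "condenses (psum r s) s"
proof -
  have r: "Well_order r" and s: "Well_order s" using le ordLeq_Well_order_simp by blast+
  obtain e where e: "compat r s e" "inj_on e (Field r)" using le by (rule ordLeq_obtain_map)
  define m where "m = case_sum (\<lambda>x. (e x, False)) (\<lambda>y. (y, True))"
  define S where "S = m ` Field (psum r s)"
  define Q where "Q = Restr (dbl s) S"
  have dbl: "Well_order (dbl s)" using s by (rule Well_order_dbl)
  have Q: "Well_order Q" unfolding Q_def using dbl by (rule Well_order_Restr)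
  have "S \<subseteq> Field (dbl s)"
    using compat_in_Field[OF e(1)] by (auto simp: S_def m_def Field_psum Field_dbl[OF s])
  then have FQ: "Field Q = S"
    unfolding Q_def using dbl by (intro Refl_Field_Restr2) (auto simp: order_on_defs)
  have "Q \<le>o dbl s"
    by (rule compat_inj_imp_ordLeq[OF Q dbl, of id]) (auto simp: compat_def Q_def)
  then have "Q \<le>o s" using limit_dbl_ordLeq[OF lim] ordLeq_transitive by blast
  moreover have "s \<le>o Q"
  proof (rule compat_inj_imp_ordLeq[OF s Q, of "\<lambda>y. (y, True)"])
    have "(y, True) \<in> S" if "y \<in> Field s" for y
      using that by (force simp: S_def m_def Field_psum)
    then show "compat s Q (\<lambda>y. (y, True))"
      by (auto simp: compat_def Q_def dbl_def intro: FieldI1 FieldI2)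
  qed (auto simp: inj_on_def)
  ultimately have "Q =o s" using ordIso_iff_ordLeq by blast
  moreover have "condenses (psum r s) Q"
  proof (rule condensesI[of m])
    have "inj_on m (Field (psum r s))"
      by (rule inj_onI) (auto simp: m_def Field_psum dest: inj_onD[OF e(2)])
    then show "bij_betw m (Field (psum r s)) (Field Q)"
      unfolding FQ S_def by (rule inj_on_imp_bij_betw)
    show "compat (psum r s) Q m"
      unfolding compat_def
    proof (intro allI impI)
      fix x y assume xy: "(x, y) \<in> psum r s"
      then have "m x \<in> S" "m y \<in> S" by (auto simp: S_def intro: FieldI1 FieldI2)
      moreover have "(m x, m y) \<in> dbl s"
        using xy e(1) by (auto simp: psum_def m_def dbl_def compat_def)
      ultimately show "(m x, m y) \<in> Q" by (simp add: Q_def)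
    qed
  qed
  ultimately show ?thesis by (rule condenses_trans[OF _ ordIso_condenses, rotated])
qed

lemma condenses_psum_natLeq_on: "condenses (psum (natLeq_on a) (natLeq_on b)) (natLeq_on (a + b))"
proof (rule condensesI[of "case_sum id (\<lambda>x. a + x)"])
  show "bij_betw (case_sum id (\<lambda>x. a + x)) (Field (psum (natLeq_on a) (natLeq_on b)))
    (Field (natLeq_on (a + b)))"
    unfolding Field_psum Field_natLeq_on
    by (rule bij_betw_byWitness[where f' = "\<lambda>x. if x < a then Inl x else Inr (x - a)"]) auto
qed (auto simp: compat_def psum_def)

text \<open>First both finite tails are moved above both left parts; then \<open>s\<close> absorbs
  \<open>r\<close>, and the tails are placed end to end.\<close>

lemma condenses_merge:
  assumes "limit_or_zero s" and "r \<le>o s"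
  shows "condenses (psum (ord_sum r (natLeq_on a)) (ord_sum s (natLeq_on b)))
    (ord_sum s (natLeq_on (a + b)))"
proof (rule condenses_trans)
  show "condenses (psum (ord_sum r (natLeq_on a)) (ord_sum s (natLeq_on b)))
    (ord_sum (psum r s) (psum (natLeq_on a) (natLeq_on b)))"
    by (rule condenses_psum_ord_sum)
  show "condenses \<dots> (ord_sum s (natLeq_on (a + b)))"
    by (intro condenses_ord_sum condenses_psum_limit condenses_psum_natLeq_on assms)
qed

lemma ordIso_ord_sum_zero:
  assumes "Well_order r"
  shows "r =o ord_sum r (natLeq_on 0)"
proof -
  have "iso r (ord_sum r (natLeq_on 0)) Inl"
    unfolding iso_iff2 Field_ord_sum Field_natLeq_on by (auto simp: bij_betw_def ord_sum_def)
  then show ?thesis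
    using assms Well_order_ord_sum[OF assms natLeq_on_Well_order] unfolding ordIso_def by blast
qed

lemma condenses_disjoint_union_insert:
  assumes "a \<notin> A"
  shows "condenses (disjoint_union (insert a A) r) (psum (r a) (disjoint_union A r))"
proof (rule condensesI[of "\<lambda>(i, x). if i = a then Inl x else Inr (i, x)"])
  show "bij_betw (\<lambda>(i, x). if i = a then Inl x else Inr (i, x))
    (Field (disjoint_union (insert a A) r)) (Field (psum (r a) (disjoint_union A r)))"
    unfolding Field_psum Field_disjoint_union using assms
    by (intro bij_betw_byWitness[where f' = "case_sum (Pair a) id"]) auto
qed (use assms in \<open>auto simp: compat_def psum_def disjoint_union_def\<close>)

lemma condenses_disjoint_union_singleton:
  assumes "condenses (r a) Q"
  shows "condenses (disjoint_union {a} r) Q"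
proof -
  have "condenses (disjoint_union {a} r) (r a)"
    by (rule condensesI[of snd])
       (auto simp: Field_disjoint_union bij_betw_def inj_on_def intro: rev_image_eqI,
        auto simp: compat_def disjoint_union_def)
  then show ?thesis using assms by (rule condenses_trans)
qed

section \<open>Sufficiency of the conditions\<close>

text \<open>The condensations of the fibres of \<open>f\<close> glue to one bijective monotone
  self-map of the union. It fails to be an automorphism because \<open>f\<close> identifies two
  components.\<close>

lemma not_reversible_if_condensing_surj:
  assumes wo: "\<And>i. i \<in> I \<Longrightarrow> Well_order (\<alpha> i)"
    and ne: "\<And>i. i \<in> I \<Longrightarrow> Field (\<alpha> i) \<noteq> {}"
    and f: "f ` I = I" "\<not> inj_on f I"
    and cond: "\<And>j. j \<in> I \<Longrightarrow> condenses (disjoint_union {i \<in> I. f i = j} \<alpha>) (\<alpha> j)"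
  shows "\<not> reversible (disjoint_union I \<alpha>)"
proof -
  let ?D = "\<lambda>j. disjoint_union {i \<in> I. f i = j} \<alpha>"
  have "\<forall>j \<in> I. \<exists>h. bij_betw h (Field (?D j)) (Field (\<alpha> j)) \<and> compat (?D j) (\<alpha> j) h"
    using cond by (simp add: condenses_def)
  from bchoice[OF this] obtain h where h: "\<And>j. j \<in> I \<Longrightarrow> bij_betw (h j) (Field (?D j)) (Field (\<alpha> j))"
    "\<And>j. j \<in> I \<Longrightarrow> compat (?D j) (\<alpha> j) (h j)"
    by blast
  have fI: "f i \<in> I" if "i \<in> I" for i using that f(1) by blast
  define F where "F = (\<lambda>(i, x). (f i, h (f i) (i, x)))"
  have hin: "h (f i) (i, x) \<in> Field (\<alpha> (f i))" if "i \<in> I" "x \<in> Field (\<alpha> i)" for i x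
    using bij_betwE[OF h(1)[OF fI[OF that(1)]]] that by (auto simp: Field_disjoint_union)
  have "bij_betw F (Sigma I (\<lambda>i. Field (\<alpha> i))) (Sigma I (\<lambda>i. Field (\<alpha> i)))"
  proof (rule bij_betw_imageI)
    show "inj_on F (Sigma I (\<lambda>i. Field (\<alpha> i)))"
    proof (rule inj_onI)
      fix p q assume pq: "p \<in> Sigma I (\<lambda>i. Field (\<alpha> i))" "q \<in> Sigma I (\<lambda>i. Field (\<alpha> i))"
        and eq: "F p = F q"
      have "h (f (fst p)) p = h (f (fst p)) q" "f (fst p) = f (fst q)"
        using eq by (auto simp: F_def split: prod.splits)
      moreover from this pq have "p \<in> Field (?D (f (fst p)))" "q \<in> Field (?D (f (fst p)))"
        by (auto simp: Field_disjoint_union)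
      ultimately show "p = q"
        using h(1)[OF fI, of "fst p"] pq by (auto simp: bij_betw_def dest: inj_onD)
    qed
    have "(j, y) \<in> F ` Sigma I (\<lambda>i. Field (\<alpha> i))" if j: "j \<in> I" and y: "y \<in> Field (\<alpha> j)" for j y
    proof -
      have "y \<in> h j ` Field (?D j)" using bij_betw_imp_surj_on[OF h(1)[OF j]] y by simp
      then obtain p where p: "y = h j p" "p \<in> Field (?D j)" by (rule imageE)
      obtain i x where "p = (i, x)" by (cases p)
      with p have "(j, y) = F p" "p \<in> Sigma I (\<lambda>i. Field (\<alpha> i))"
        by (simp_all add: Field_disjoint_union F_def)
      then show ?thesis by (rule image_eqI)
    qed
    then show "F ` Sigma I (\<lambda>i. Field (\<alpha> i)) = Sigma I (\<lambda>i. Field (\<alpha> i))"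
      using hin fI by (auto simp: F_def)
  qed
  moreover have "order_preserving (disjoint_union I \<alpha>) F"
    unfolding order_preserving_def
  proof (intro ballI impI)
    fix p q assume "(p, q) \<in> disjoint_union I \<alpha>"
    then obtain i x y where pq: "p = (i, x)" "q = (i, y)" "i \<in> I" "(x, y) \<in> \<alpha> i"
      by (auto simp: disjoint_union_def)
    then have "((i, x), (i, y)) \<in> ?D (f i)" by (auto simp: disjoint_union_def)
    then have "(h (f i) (i, x), h (f i) (i, y)) \<in> \<alpha> (f i)"
      using h(2)[OF fI[OF pq(3)]] by (auto simp: compat_def)
    then show "(F p, F q) \<in> disjoint_union I \<alpha>"
      using pq fI by (auto simp: F_def disjoint_union_def)
  qed
  \<comment> \<open>Points of two components with the same image index are incomparable, but their
    images lie in one chain.\<close>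
  moreover have "\<not> order_automorphism (disjoint_union I \<alpha>) F"
  proof -
    obtain i k where ik: "i \<in> I" "k \<in> I" "i \<noteq> k" "f i = f k"
      using f(2) by (auto simp: inj_on_def)
    obtain x y where xy: "x \<in> Field (\<alpha> i)" "y \<in> Field (\<alpha> k)" using ne ik by blast
    have "h (f i) (i, x) \<in> Field (\<alpha> (f i))" "h (f i) (k, y) \<in> Field (\<alpha> (f i))"
      using hin[OF ik(1) xy(1)] hin[OF ik(2) xy(2)] ik(4) by simp_all
    then have "(F (i, x), F (k, y)) \<in> disjoint_union I \<alpha> \<or> (F (k, y), F (i, x)) \<in> disjoint_union I \<alpha>"
      using Well_order_linear[OF wo[OF fI[OF ik(1)]]] ik(4) fI[OF ik(1)]
      by (simp add: F_def disjoint_union_def)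
    moreover have "((i, x), (k, y)) \<notin> disjoint_union I \<alpha>" "((k, y), (i, x)) \<notin> disjoint_union I \<alpha>"
      using ik by (auto simp: disjoint_union_def)
    moreover have "(i, x) \<in> Field (disjoint_union I \<alpha>)" "(k, y) \<in> Field (disjoint_union I \<alpha>)"
      using ik xy by (auto simp: Field_disjoint_union)
    ultimately show ?thesis unfolding order_automorphism_def by blast
  qed
  ultimately show ?thesis
    unfolding reversible_def Field_disjoint_union by blast
qed

text \<open>Components are merged one at a time; each step is \<open>condenses_merge\<close> with
  both left parts equal to \<delta>, so the left part stays \<delta> and the tail lengths
  add.\<close>

lemma condenses_same_limit_fibre:
  assumes lim: "limit_or_zero \<delta>" and fin: "finite A" "A \<noteq> {}"
    and eq: "\<And>i. i \<in> A \<Longrightarrow> \<alpha> i =o ord_sum (\<gamma> i) (natLeq_on (n i))"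
      "\<And>i. i \<in> A \<Longrightarrow> \<gamma> i =o \<delta>"
  shows "condenses (disjoint_union A \<alpha>) (ord_sum \<delta> (natLeq_on (\<Sum>i \<in> A. n i)))"
  using fin eq
proof (induction rule: finite_ne_induct)
  have \<alpha>: "condenses (\<alpha> i) (ord_sum \<delta> (natLeq_on (n i)))"
    if "\<alpha> i =o ord_sum (\<gamma> i) (natLeq_on (n i))" "\<gamma> i =o \<delta>" for i
    using condenses_trans[OF ordIso_condenses[OF that(1)]
        condenses_ord_sum[OF ordIso_condenses[OF that(2)] condenses_refl]] .
  {
    case (singleton a)
    then have "condenses (\<alpha> a) (ord_sum \<delta> (natLeq_on (n a)))" by (intro \<alpha>) auto
    then show ?case by (simp add: condenses_disjoint_union_singleton)
  next
    case (insert a A)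
    have "\<delta> \<le>o \<delta>" using lim by (simp add: limit_or_zero_def ordLeq_reflexive)
    have "condenses (disjoint_union (insert a A) \<alpha>) (psum (\<alpha> a) (disjoint_union A \<alpha>))"
      using insert.hyps by (intro condenses_disjoint_union_insert)
    also have "condenses \<dots> (psum (ord_sum \<delta> (natLeq_on (n a)))
        (ord_sum \<delta> (natLeq_on (\<Sum>i \<in> A. n i))))"
      using insert by (intro condenses_psum \<alpha>) auto
    also have "condenses \<dots> (ord_sum \<delta> (natLeq_on (n a + (\<Sum>i \<in> A. n i))))"
      by (rule condenses_merge) fact+
    finally show ?case using insert.hyps by simp
  }
qed

text \<open>A Hilbert hotel argument: a sequence of distinct elements of \<open>S\<close>, chosen to
  avoid \<open>k\<close>, is shifted down by one place, and its first element is sent to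
  \<open>k\<close>. All other indices stay fixed, so only the fibre over \<open>k\<close> has two
  elements.\<close>

lemma infinite_shift_absorbing:
  assumes inf: "infinite S" and "S \<subseteq> I" and k: "k \<in> I"
  obtains f s where "f ` I = I" "\<not> inj_on f I" "s \<in> S" "s \<noteq> k"
    "{i \<in> I. f i = k} = {s, k}"
    "\<And>j. j \<in> I \<Longrightarrow> j \<noteq> k \<Longrightarrow> \<exists>i. {i \<in> I. f i = j} = {i} \<and> (i = j \<or> i \<in> S \<and> j \<in> S)"
proof -
  obtain g :: "nat \<Rightarrow> 'a" where g: "inj g" "range g \<subseteq> S - {k}"
    using infinite_countable_subset[of "S - {k}"] inf by auto
  \<comment> \<open>The case \<open>i = g 0\<close> comes first, so the subtraction only ever meets
    positive positions.\<close>
  define f where "f = (\<lambda>i. if i = g 0 then k else if i \<in> range g then g (inv g i - 1) else i)"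
  have f: "f (g 0) = k" "f (g (Suc m)) = g m" "i \<notin> range g \<Longrightarrow> f i = i" for m i
    using g(1) by (auto simp: f_def inj_eq)
  have gS: "g m \<in> S" "g m \<noteq> k" "g m \<in> I" for m using g(2) \<open>S \<subseteq> I\<close> by blast+
  have cases: "(\<exists>m. i = g (Suc m)) \<or> i = g 0 \<or> i \<notin> range g" for i
    by (metis not0_implies_Suc rangeE)
  have fib_k: "{i \<in> I. f i = k} = {g 0, k}"
  proof -
    have "i = g 0 \<or> i = k" if "f i = k" for i
      using cases[of i] that f gS(2) by metis
    moreover have "f k = k" using f(3) gS(2) by (metis rangeE)
    ultimately show ?thesis using f(1) gS(3) k by auto
  qed
  have fib_g: "{i \<in> I. f i = g m} = {g (Suc m)}" for m
  proof -
    have "i = g (Suc m)" if "f i = g m" for i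
      using cases[of i] that f gS(2) g(1) by (metis injD rangeI)
    then show ?thesis using f(2) gS by auto
  qed
  have fib_j: "{i \<in> I. f i = j} = {j}" if "j \<in> I" "j \<noteq> k" "j \<notin> range g" for j
  proof -
    have "i = j" if "f i = j" for i
      using cases[of i] that \<open>j \<noteq> k\<close> \<open>j \<notin> range g\<close> f by (metis rangeI)
    moreover have "f j = j" using f(3)[OF that(3)] .
    ultimately show ?thesis using that(1) by blast
  qed
  have fib: "\<exists>i. {i \<in> I. f i = j} = {i} \<and> (i = j \<or> i \<in> S \<and> j \<in> S)" if "j \<in> I" "j \<noteq> k" for j
    using fib_g fib_j[OF that] gS(1) by (metis rangeE)
  show thesis
  proof (rule that[of f "g 0"])
    show "f ` I = I"
    proof
      show "f ` I \<subseteq> I" using cases f gS(3) k by (metis image_subsetI)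
      have "{i \<in> I. f i = j} \<noteq> {}" if "j \<in> I" for j
        using fib_k fib[OF that] by (cases "j = k") blast+
      then show "I \<subseteq> f ` I" by blast
    qed
    have "f (g 0) = f k" using f(1,3) gS(2) by (metis rangeE)
    then show "\<not> inj_on f I" using gS(2,3)[of 0] k by (auto dest: inj_onD)
  qed (use gS fib_k fib in auto)
qed

text \<open>This is sufficiency of (A), with \<delta> the limit part of \<open>\<alpha> k\<close>.
  The shift moves indices only within the class of \<beta>, where all components are isomorphic,
  except that one copy of \<beta> goes to \<open>k\<close> and is absorbed by \<delta>.\<close>

lemma not_reversible_if_infinite_class:
  assumes wo: "\<And>i. i \<in> I \<Longrightarrow> Well_order (\<alpha> i)"
    and ne: "\<And>i. i \<in> I \<Longrightarrow> Field (\<alpha> i) \<noteq> {}"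
    and lim: "limit_or_zero \<delta>"
    and k: "k \<in> I" "\<alpha> k =o ord_sum \<delta> (natLeq_on m)"
    and le: "\<beta> \<le>o \<delta>" and inf: "infinite (same_ordinal I \<alpha> \<beta>)"
  shows "\<not> reversible (disjoint_union I \<alpha>)"
proof -
  have sub: "same_ordinal I \<alpha> \<beta> \<subseteq> I" by (auto simp: same_ordinal_def)
  obtain f s where f: "f ` I = I" "\<not> inj_on f I"
    and s: "s \<in> same_ordinal I \<alpha> \<beta>" "s \<noteq> k" "{i \<in> I. f i = k} = {s, k}"
    and fib: "\<And>j. j \<in> I \<Longrightarrow> j \<noteq> k \<Longrightarrow> \<exists>i. {i \<in> I. f i = j} = {i} \<and>
      (i = j \<or> i \<in> same_ordinal I \<alpha> \<beta> \<and> j \<in> same_ordinal I \<alpha> \<beta>)"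
    by (rule infinite_shift_absorbing[OF inf sub k(1)]) (rule that)
  show ?thesis
  proof (rule not_reversible_if_condensing_surj[OF wo ne f])
    fix j assume j: "j \<in> I"
    show "condenses (disjoint_union {i \<in> I. f i = j} \<alpha>) (\<alpha> j)"
    proof (cases "j = k")
      case True
      have "\<alpha> s =o \<beta>" using s(1) by (simp add: same_ordinal_def)
      \<comment> \<open>Giving \<beta> an empty tail makes \<open>condenses_merge\<close> applicable
        even if \<beta> is a successor, and leaves the tail length \<open>m\<close>
        unchanged.\<close>
      then have 1: "condenses (\<alpha> s) (ord_sum \<beta> (natLeq_on 0))"
        using ordIso_condenses ordIso_transitive ordIso_ord_sum_zero ordLeq_Well_order_simp[OF le]
        by blast
      have 2: "condenses (disjoint_union {k} \<alpha>) (ord_sum \<delta> (natLeq_on m))"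
        by (intro condenses_disjoint_union_singleton ordIso_condenses k(2))
      have "condenses (disjoint_union {s, k} \<alpha>) (psum (\<alpha> s) (disjoint_union {k} \<alpha>))"
        using s(2) by (intro condenses_disjoint_union_insert) simp
      also have "condenses \<dots> (psum (ord_sum \<beta> (natLeq_on 0)) (ord_sum \<delta> (natLeq_on m)))"
        using 1 2 by (rule condenses_psum)
      also have "condenses \<dots> (ord_sum \<delta> (natLeq_on (0 + m)))"
        using lim le by (rule condenses_merge)
      also have "condenses \<dots> (\<alpha> k)"
        using ordIso_condenses[OF ordIso_symmetric[OF k(2)]] by simp
      finally show ?thesis using True s(3) by simp
    next
      case False
      then obtain i where i: "{i \<in> I. f i = j} = {i}"
        and ij: "i = j \<or> i \<in> same_ordinal I \<alpha> \<beta> \<and> j \<in> same_ordinal I \<alpha> \<beta>"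
        using fib[OF j] by blast
      have "\<alpha> i =o \<alpha> j"
        using ij ordIso_reflexive[OF wo[OF j]] ordIso_symmetric ordIso_transitive
        unfolding same_ordinal_def by blast
      then show ?thesis
        unfolding i by (intro condenses_disjoint_union_singleton ordIso_condenses)
    qed
  qed
qed

text \<open>This yields sufficiency of (B). The witness \<open>g\<close> on \<open>J\<close> is
  extended by the identity. Over \<open>j\<close> in \<open>J\<close> the fibre condenses to
  \<delta> followed by the sum of its tail lengths, which is \<open>n j\<close>; the other fibres
  are singletons.\<close>

lemma not_reversible_if_tail_sequence:
  assumes wo: "\<And>i. i \<in> I \<Longrightarrow> Well_order (\<alpha> i)"
    and ne: "\<And>i. i \<in> I \<Longrightarrow> Field (\<alpha> i) \<noteq> {}"
    and eq: "\<And>i. i \<in> I \<Longrightarrow> \<alpha> i =o ord_sum (\<gamma> i) (natLeq_on (n i))"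
    and lim: "limit_or_zero \<delta>"
    and J: "J \<subseteq> same_ordinal I \<gamma> \<delta>" and seq: "\<not> reversible_sequence J n"
  shows "\<not> reversible (disjoint_union I \<alpha>)"
proof -
  have JI: "J \<subseteq> I" and \<gamma>: "\<And>i. i \<in> J \<Longrightarrow> \<gamma> i =o \<delta>" using J by (auto simp: same_ordinal_def)
  obtain g where g: "g ` J = J" "\<not> bij_betw g J J"
    and sum: "\<And>j. j \<in> J \<Longrightarrow> finite {i \<in> J. g i = j} \<and> (\<Sum>i \<in> {i \<in> J. g i = j}. n i) = n j"
    using seq by (auto simp: reversible_sequence_def)
  define f where "f = (\<lambda>i. if i \<in> J then g i else i)"
  have fib_J: "{i \<in> I. f i = j} = {i \<in> J. g i = j}" if "j \<in> J" for j
    using that JI by (auto simp: f_def)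
  have fib_not_J: "{i \<in> I. f i = j} = {j}" if "j \<in> I" "j \<notin> J" for j
    using that g(1) by (auto simp: f_def)
  show ?thesis
  proof (rule not_reversible_if_condensing_surj[OF wo ne])
    show "f ` I = I"
    proof
      show "f ` I \<subseteq> I" using g(1) JI by (auto simp: f_def)
      show "I \<subseteq> f ` I"
      proof
        fix j assume j: "j \<in> I"
        show "j \<in> f ` I"
        proof (cases "j \<in> J")
          case True
          then obtain i where "i \<in> J" "j = g i" using g(1) by blast
          then show ?thesis using JI by (intro image_eqI[of _ _ i]) (auto simp: f_def)
        next
          case False
          then show ?thesis using j by (intro image_eqI[of _ _ j]) (auto simp: f_def)
        qed
      qed
    qed
    show "\<not> inj_on f I"
    proof
      assume "inj_on f I"
      then have "inj_on f J" using JI by (rule inj_on_subset)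
      then have "inj_on g J" by (simp add: f_def inj_on_def)
      then show False using g by (simp add: bij_betw_def)
    qed
    fix j assume j: "j \<in> I"
    show "condenses (disjoint_union {i \<in> I. f i = j} \<alpha>) (\<alpha> j)"
    proof (cases "j \<in> J")
      case True
      have "j \<in> g ` J" using True g(1) by simp
      then have "{i \<in> J. g i = j} \<noteq> {}" by auto
      then have "condenses (disjoint_union {i \<in> J. g i = j} \<alpha>)
          (ord_sum \<delta> (natLeq_on (\<Sum>i \<in> {i \<in> J. g i = j}. n i)))"
      proof (rule condenses_same_limit_fibre[OF lim conjunct1[OF sum[OF True]]])
        fix i assume "i \<in> {i \<in> J. g i = j}"
        then have "i \<in> J" "i \<in> I" using JI by auto
        then show "\<alpha> i =o ord_sum (\<gamma> i) (natLeq_on (n i))" "\<gamma> i =o \<delta>"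
          using eq \<gamma> by simp_all
      qed
      then have "condenses (disjoint_union {i \<in> I. f i = j} \<alpha>) (ord_sum \<delta> (natLeq_on (n j)))"
        using sum[OF True] fib_J[OF True] by simp
      also have "condenses \<dots> (ord_sum (\<gamma> j) (natLeq_on (n j)))"
        by (intro condenses_ord_sum condenses_refl ordIso_condenses ordIso_symmetric[OF \<gamma>[OF True]])
      also have "condenses \<dots> (\<alpha> j)" using ordIso_condenses[OF ordIso_symmetric[OF eq[OF j]]] .
      finally show ?thesis .
    next
      case False
      show ?thesis
        unfolding fib_not_J[OF j False]
        by (intro condenses_disjoint_union_singleton condenses_refl)
    qed
  qed
qed

section \<open>Necessity of the conditions\<close>

text \<open>Any two points of a component are comparable, so their images share a component, whose
  index \<open>f i\<close> can be read off at a base point \<open>c i\<close>. The map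
  \<open>g i\<close> is the second coordinate of \<open>F\<close> on component
  \<open>i\<close>.\<close>

lemma bijective_preserving_components:
  assumes wo: "\<And>i. i \<in> I \<Longrightarrow> Well_order (\<alpha> i)"
    and ne: "\<And>i. i \<in> I \<Longrightarrow> Field (\<alpha> i) \<noteq> {}"
    and F: "bij_betw F (Field (disjoint_union I \<alpha>)) (Field (disjoint_union I \<alpha>))"
      "order_preserving (disjoint_union I \<alpha>) F" "\<not> order_automorphism (disjoint_union I \<alpha>) F"
  obtains f g where "f ` I = I" "\<not> inj_on f I"
    "\<And>i. i \<in> I \<Longrightarrow> compat (\<alpha> i) (\<alpha> (f i)) (g i)"
    "\<And>i. i \<in> I \<Longrightarrow> inj_on (g i) (Field (\<alpha> i))"
    "\<And>j. j \<in> I \<Longrightarrow>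
      bij_betw (\<lambda>(i, x). g i x) (Sigma {i \<in> I. f i = j} (\<lambda>i. Field (\<alpha> i))) (Field (\<alpha> j))"
proof -
  let ?X = "Sigma I (\<lambda>i. Field (\<alpha> i))"
  define c where "c = (\<lambda>i. SOME x. x \<in> Field (\<alpha> i))"
  have c: "c i \<in> Field (\<alpha> i)" if "i \<in> I" for i
    unfolding c_def using ne[OF that] by (simp add: some_in_eq)
  define f where "f = (\<lambda>i. fst (F (i, c i)))"
  define g where "g = (\<lambda>i x. snd (F (i, x)))"
  have bij: "bij_betw F ?X ?X" using F(1) by (simp add: Field_disjoint_union)
  have mono: "fst (F (i, x)) = fst (F (i, y)) \<and> fst (F (i, x)) \<in> I
      \<and> (g i x, g i y) \<in> \<alpha> (fst (F (i, x)))" if "i \<in> I" "(x, y) \<in> \<alpha> i" for i x y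
  proof -
    have "((i, x), (i, y)) \<in> disjoint_union I \<alpha>" using that by (auto simp: disjoint_union_def)
    then have "(F (i, x), F (i, y)) \<in> disjoint_union I \<alpha>"
      using F(2) by (auto simp: order_preserving_def intro: FieldI1 FieldI2)
    then show ?thesis by (auto simp: disjoint_union_def g_def)
  qed
  have fst_eq: "fst (F (i, x)) = f i" if "i \<in> I" "x \<in> Field (\<alpha> i)" for i x
    using Well_order_linear[OF wo that(2) c] mono that(1) unfolding f_def by metis
  have F_eq: "F (i, x) = (f i, g i x)" if "i \<in> I" "x \<in> Field (\<alpha> i)" for i x
    using fst_eq[OF that] by (simp add: g_def prod_eq_iff)
  have compat: "compat (\<alpha> i) (\<alpha> (f i)) (g i)" if "i \<in> I" for i
    unfolding compat_def using mono[OF that] fst_eq[OF that] by (metis FieldI1)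
  have inj: "inj_on (g i) (Field (\<alpha> i))" if "i \<in> I" for i
    using bij F_eq[OF that] that by (fastforce simp: bij_betw_def inj_on_def)
  have fI: "f i \<in> I" if "i \<in> I" for i
    using bij_betwE[OF bij] F_eq[OF that c[OF that]] that c by fastforce
  have onto: "\<exists>i \<in> I. \<exists>x \<in> Field (\<alpha> i). f i = j \<and> g i x = y" if "j \<in> I" "y \<in> Field (\<alpha> j)" for j y
  proof -
    have "(j, y) \<in> F ` ?X" using bij that by (auto simp: bij_betw_def)
    then obtain i x where "i \<in> I" "x \<in> Field (\<alpha> i)" "(j, y) = F (i, x)" by blast
    with F_eq[of i x] show ?thesis by auto
  qed
  show thesis
  proof (rule that[of f g])
    show "f ` I = I" using fI onto c by blast
    show "bij_betw (\<lambda>(i, x). g i x) (Sigma {i \<in> I. f i = j} (\<lambda>i. Field (\<alpha> i))) (Field (\<alpha> j))"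
      if j: "j \<in> I" for j
    proof (rule bij_betw_imageI)
      show "inj_on (\<lambda>(i, x). g i x) (Sigma {i \<in> I. f i = j} (\<lambda>i. Field (\<alpha> i)))"
      proof (rule inj_onI)
        fix p q
        assume "p \<in> Sigma {i \<in> I. f i = j} (\<lambda>i. Field (\<alpha> i))"
          "q \<in> Sigma {i \<in> I. f i = j} (\<lambda>i. Field (\<alpha> i))"
          "(\<lambda>(i, x). g i x) p = (\<lambda>(i, x). g i x) q"
        then have "F p = F q" "p \<in> ?X" "q \<in> ?X" using F_eq by auto
        then show "p = q" using bij by (auto simp: bij_betw_def dest: inj_onD)
      qed
      show "(\<lambda>(i, x). g i x) ` Sigma {i \<in> I. f i = j} (\<lambda>i. Field (\<alpha> i)) = Field (\<alpha> j)"
      proof (intro equalityI subsetI)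
        fix y assume "y \<in> Field (\<alpha> j)"
        then obtain i x where "i \<in> I" "x \<in> Field (\<alpha> i)" "f i = j" "g i x = y"
          using onto[OF j] by blast
        then show "y \<in> (\<lambda>(i, x). g i x) ` Sigma {i \<in> I. f i = j} (\<lambda>i. Field (\<alpha> i))"
          by (intro image_eqI[of _ _ "(i, x)"]) simp_all
      qed (auto dest: compat_in_Field[OF compat])
    qed
    show "\<not> inj_on f I"
    proof
      assume f: "inj_on f I"
      \<comment> \<open>If \<open>f\<close> were injective, comparable images would come from a
        single component. An injective monotone map between chains reflects the order, so
        \<open>F\<close> would be an automorphism.\<close>
      have "(p, q) \<in> disjoint_union I \<alpha>"
        if pq: "p \<in> ?X" "q \<in> ?X" and "(F p, F q) \<in> disjoint_union I \<alpha>" for p q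
      proof -
        obtain i x k y where *: "p = (i, x)" "q = (k, y)" by (metis surj_pair)
        then have "f i = f k" and gxy: "(g i x, g k y) \<in> \<alpha> (f i)" and i: "i \<in> I" "k \<in> I"
          using that F_eq by (auto simp: disjoint_union_def)
        then have [simp]: "k = i" using f by (auto dest: inj_onD)
        have xy: "x \<in> Field (\<alpha> i)" "y \<in> Field (\<alpha> i)" using pq * by auto
        have "(x, y) \<in> \<alpha> i"
        proof (rule ccontr)
          assume "(x, y) \<notin> \<alpha> i"
          then have yx: "(y, x) \<in> \<alpha> i" using Well_order_linear[OF wo[OF i(1)] xy] by blast
          then have "(g i y, g i x) \<in> \<alpha> (f i)" using compat[OF i(1)] by (auto simp: compat_def)
          then have "g i x = g i y" using gxy Well_order_antisymD[OF wo[OF fI[OF i(1)]]] by auto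
          then have "x = y" using inj[OF i(1)] xy by (auto dest: inj_onD)
          then show False using yx \<open>(x, y) \<notin> \<alpha> i\<close> by simp
        qed
        then show ?thesis using i * by (auto simp: disjoint_union_def)
      qed
      then have "order_automorphism (disjoint_union I \<alpha>) F"
        using F(1,2) unfolding order_automorphism_def order_preserving_def Field_disjoint_union
        by blast
      then show False using F(3) by blast
    qed
  qed (use compat inj in auto)
qed

text \<open>Since \<open>f\<close> never lowers the order type, an index entering the class of
  \<beta> from outside has a strictly smaller type. By induction \<open>f\<close> keeps that index
  in its own class, a contradiction. The predicate \<open>Q\<close> marks a downward closed range of
  types with finite classes, on which the induction runs.\<close>

lemma surj_bijective_on_finite_classes:
  assumes wo: "\<And>i. i \<in> I \<Longrightarrow> Well_order (\<alpha> i)"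
    and surj: "f ` I = I" and le: "\<And>i. i \<in> I \<Longrightarrow> \<alpha> i \<le>o \<alpha> (f i)"
    and fin: "\<And>\<beta>. Q \<beta> \<Longrightarrow> finite (same_ordinal I \<alpha> \<beta>)"
    and down: "\<And>\<beta> i. Q \<beta> \<Longrightarrow> i \<in> I \<Longrightarrow> \<alpha> i <o \<beta> \<Longrightarrow> Q (\<alpha> i)"
    and "Q \<beta>"
  shows "inj_on f (same_ordinal I \<alpha> \<beta>) \<and>
    (\<forall>i \<in> I. f i \<in> same_ordinal I \<alpha> \<beta> \<longleftrightarrow> i \<in> same_ordinal I \<alpha> \<beta>)"
  using \<open>Q \<beta>\<close>
proof (induction \<beta> rule: wf_induct_rule[OF wf_ordLess])
  case (1 \<beta>)
  let ?S = "same_ordinal I \<alpha> \<beta>"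
  have refl: "i \<in> ?S" if i: "i \<in> I" and fS: "f i \<in> ?S" for i
  proof (rule ccontr)
    assume "i \<notin> ?S"
    have "\<alpha> i \<le>o \<beta>" using le[OF i] fS ordLeq_ordIso_trans by (auto simp: same_ordinal_def)
    then have less: "\<alpha> i <o \<beta>"
      using \<open>i \<notin> ?S\<close> i ordLeq_iff_ordLess_or_ordIso by (auto simp: same_ordinal_def)
    then have "f i \<in> same_ordinal I \<alpha> (\<alpha> i)"
      using "1.IH"[OF less down[OF "1.prems" i less]] i wo ordIso_reflexive
      by (auto simp: same_ordinal_def)
    then have "\<beta> =o \<alpha> i"
      using fS ordIso_transitive ordIso_symmetric by (fastforce simp: same_ordinal_def)
    then show False using less ordIso_symmetric not_ordLess_ordIso by blast
  qed
  have sub: "?S \<subseteq> f ` ?S"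
  proof
    fix j assume j: "j \<in> ?S"
    then obtain i where "i \<in> I" "j = f i" using surj by (auto simp: same_ordinal_def)
    then show "j \<in> f ` ?S" using refl j by blast
  qed
  have finS: "finite ?S" using fin "1.prems" .
  \<comment> \<open>By surjectivity the image covers the class; finiteness forces equality, and then
    injectivity.\<close>
  then have S: "f ` ?S = ?S"
    using card_seteq[OF _ sub] card_image_le by (metis finite_imageI)
  then have "inj_on f ?S" using finS by (simp add: eq_card_imp_inj_on)
  then show ?case using S refl by blast
qed

text \<open>Above a point sent into the tail there is always a larger point of \<open>r\<close>,
  which must go to a later tail position. Thus \<open>n - m\<close> would decrease forever.\<close>

lemma limit_image_in_left:
  assumes lim: "limit_or_zero r" and h: "compat r (ord_sum s (natLeq_on n)) h" "inj_on h (Field r)"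
    and x: "x \<in> Field r"
  shows "h x \<in> Inl ` Field s"
proof -
  have r: "Well_order r" using lim by (simp add: limit_or_zero_def)
  have F: "h y \<in> Inl ` Field s \<union> Inr ` {m. m < n}" if "y \<in> Field r" for y
    using compat_in_Field[OF h(1) that] unfolding Field_ord_sum Field_natLeq_on .
  have "False" if "x \<in> Field r" "h x = Inr m" for x m
    using that
  proof (induction "n - m" arbitrary: x m rule: less_induct)
    case less
    obtain y where y: "y \<in> Field r" "(y, x) \<notin> r"
      using lim less.prems(1) by (auto simp: limit_or_zero_def)
    then have xy: "(x, y) \<in> r" "x \<noteq> y"
      using Well_order_linear[OF r] Well_order_reflD[OF r] less.prems(1) by blast+
    have "(h x, h y) \<in> ord_sum s (natLeq_on n)" using h(1) xy(1) by (simp add: compat_def)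
    moreover have "h x \<noteq> h y" using inj_onD[OF h(2)] xy(2) y(1) less.prems(1) by blast
    ultimately obtain m' where "h y = Inr m'" "m < m'" "m' < n"
      using less.prems(2) by (auto simp: ord_sum_def)
    moreover from this have "n - m' < n - m" by linarith
    ultimately show False using less.hyps y(1) by blast
  qed
  then show ?thesis using F[OF x] x by blast
qed

text \<open>An injective monotone map from a limit order avoids the finite tail, so it already lands
  in \<open>s\<close>. This allows limit parts to be compared through the full orders.\<close>

lemma limit_ordLeq_ord_sumD:
  assumes lim: "limit_or_zero r" and s: "Well_order s" and le: "r \<le>o ord_sum s (natLeq_on n)"
  shows "r \<le>o s"
proof -
  have r: "Well_order r" using lim by (simp add: limit_or_zero_def)
  obtain h where h: "compat r (ord_sum s (natLeq_on n)) h" "inj_on h (Field r)"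
    using le by (rule ordLeq_obtain_map)
  have L: "\<exists>y. h x = Inl y" if "x \<in> Field r" for x
    using limit_image_in_left[OF lim h that] by blast
  show ?thesis
  proof (rule compat_inj_imp_ordLeq[OF r s, of "projl \<circ> h"])
    show "compat r s (projl \<circ> h)"
      unfolding compat_def
    proof (intro allI impI)
      fix x y assume xy: "(x, y) \<in> r"
      then obtain a b where "h x = Inl a" "h y = Inl b" using L by (meson FieldI1 FieldI2)
      moreover have "(h x, h y) \<in> ord_sum s (natLeq_on n)" using h(1) xy by (auto simp: compat_def)
      ultimately show "((projl \<circ> h) x, (projl \<circ> h) y) \<in> s" by (auto simp: ord_sum_def)
    qed
    show "inj_on (projl \<circ> h) (Field r)"
    proof (rule inj_onI)
      fix x y assume xy: "x \<in> Field r" "y \<in> Field r" "(projl \<circ> h) x = (projl \<circ> h) y"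
      then obtain a b where "h x = Inl a" "h y = Inl b" using L by blast
      then have "h x = h y" using xy(3) by simp
      then show "x = y" using inj_onD[OF h(2)] xy by blast
    qed
  qed
qed

lemma ordLeq_ord_sum:
  assumes "Well_order r" "Well_order s"
  shows "r \<le>o ord_sum r s"
  by (rule compat_inj_imp_ordLeq[OF assms(1) Well_order_ord_sum[OF assms], of Inl])
     (auto simp: compat_def ord_sum_def)

text \<open>Left points stay left by \<open>limit_image_in_left\<close>. If a tail point
  \<open>x\<close> went to \<open>Inl z\<close>, then all left points would have images below
  \<open>z\<close>; but the left parts are isomorphic, and a monotone injection of \<open>s\<close>
  into itself sends \<open>z\<close> to a point at or above \<open>z\<close>.\<close>

lemma compat_preserves_tails:
  assumes lim: "limit_or_zero r" and iso: "s =o r"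
    and h: "compat (ord_sum r (natLeq_on a)) (ord_sum s (natLeq_on b)) h"
      "inj_on h (Field (ord_sum r (natLeq_on a)))"
    and x: "x \<in> Field (ord_sum r (natLeq_on a))"
  shows "isl (h x) \<longleftrightarrow> isl x"
proof -
  have s: "Well_order s" using iso by (simp add: ordIso_def)
  have F: "Inl y \<in> Field (ord_sum r (natLeq_on a))" if "y \<in> Field r" for y
    using that by (simp add: Field_ord_sum)
  have L: "h (Inl y) \<in> Inl ` Field s" if "y \<in> Field r" for y
  proof -
    have "compat r (ord_sum s (natLeq_on b)) (h \<circ> Inl)"
      using h(1) by (auto simp: compat_def ord_sum_def)
    moreover have "inj_on (h \<circ> Inl) (Field r)"
      using h(2) F by (auto simp: inj_on_def)
    ultimately show ?thesis using limit_image_in_left[OF lim _ _ that] by fastforce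
  qed
  show ?thesis
  proof (cases x)
    case (Inl y)
    then have "y \<in> Field r" using x by (auto simp: Field_ord_sum)
    then obtain z where "h (Inl y) = Inl z" using L by blast
    then show ?thesis using Inl by simp
  next
    case (Inr m)
    have "\<not> isl (h x)"
    proof
      assume "isl (h x)"
      moreover have "h x \<in> Field (ord_sum s (natLeq_on b))" using compat_in_Field[OF h(1) x] .
      ultimately obtain z where z: "h x = Inl z" "z \<in> Field s" by (auto simp: Field_ord_sum)
      obtain e where "iso s r e" using iso by (auto simp: ordIso_def)
      then have e: "compat s r e" "inj_on e (Field s)"
        by (auto simp: compat_def iso_forward iso_imp_inj_on)
      have eF: "e y \<in> Field r" if "y \<in> Field s" for y using compat_in_Field[OF e(1) that] .
      \<comment> \<open>The isomorphism \<open>e\<close> turns the left part of \<open>h\<close>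
        into a self-map of \<open>s\<close>. Inflation gives \<open>z\<close> below
        \<open>\<phi> z\<close>, while \<open>Inl (e z)\<close> lying below \<open>x\<close> gives
        the converse. Equality would make \<open>h\<close> identify \<open>Inl (e z)\<close> with
        the tail point \<open>x\<close>.\<close>
      define \<phi> where "\<phi> = (\<lambda>y. projl (h (Inl (e y))))"
      have \<phi>: "h (Inl (e y)) = Inl (\<phi> y)" if "y \<in> Field s" for y
        using L[OF eF[OF that]] by (auto simp: \<phi>_def)
      have "compat s s \<phi>"
        unfolding compat_def
      proof (intro allI impI)
        fix y y' assume yy': "(y, y') \<in> s"
        then have "(Inl (e y), Inl (e y')) \<in> ord_sum r (natLeq_on a)"
          using e(1) by (auto simp: compat_def ord_sum_def)
        then have "(h (Inl (e y)), h (Inl (e y'))) \<in> ord_sum s (natLeq_on b)"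
          using h(1) by (auto simp: compat_def)
        then show "(\<phi> y, \<phi> y') \<in> s"
          using \<phi>[OF FieldI1[OF yy']] \<phi>[OF FieldI2[OF yy']] by (auto simp: ord_sum_def)
      qed
      moreover have "inj_on \<phi> (Field s)"
      proof (rule inj_onI)
        fix y y' assume y: "y \<in> Field s" "y' \<in> Field s" "\<phi> y = \<phi> y'"
        then have "h (Inl (e y)) = h (Inl (e y'))" using \<phi> by simp
        then have "e y = e y'" using h(2) F eF y by (auto dest: inj_onD)
        then show "y = y'" using e(2) y by (auto dest: inj_onD)
      qed
      ultimately have "(z, \<phi> z) \<in> s" using self_compat_inflationary[OF s] z(2) by blast
      moreover have "m \<in> Field (natLeq_on a)" using x unfolding Inr Field_ord_sum by blast
      then have "(Inl (e z), x) \<in> ord_sum r (natLeq_on a)"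
        using eF[OF z(2)] unfolding Inr ord_sum_def by blast
      then have "(h (Inl (e z)), h x) \<in> ord_sum s (natLeq_on b)"
        using h(1) unfolding compat_def by blast
      then have "(Inl (\<phi> z), Inl z) \<in> ord_sum s (natLeq_on b)"
        unfolding \<phi>[OF z(2)] z(1) .
      then have "(\<phi> z, z) \<in> s" by (auto simp: ord_sum_def)
      ultimately have "\<phi> z = z" using Well_order_antisymD[OF s] by blast
      then have "h (Inl (e z)) = h x" using \<phi>[OF z(2)] z(1) by simp
      then have "Inl (e z) = x" using h(2) F[OF eF[OF z(2)]] x by (auto dest: inj_onD)
      then show False using Inr by simp
    qed
    then show ?thesis using Inr by simp
  qed
qed

lemma card_tail:
  assumes "iso r (ord_sum s (natLeq_on k)) w"
  shows "finite {x \<in> Field r. \<not> isl (w x)}" "card {x \<in> Field r. \<not> isl (w x)} = k"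
proof -
  have w: "bij_betw w (Field r) (Inl ` Field s \<union> Inr ` {x. x < k})"
    using assms unfolding iso_def Field_ord_sum Field_natLeq_on by blast
  have "w ` {x \<in> Field r. \<not> isl (w x)} = {z \<in> w ` Field r. \<not> isl z}" by blast
  also have "\<dots> = Inr ` {..<k}" unfolding bij_betw_imp_surj_on[OF w] by auto
  finally have bij: "bij_betw w {x \<in> Field r. \<not> isl (w x)} (Inr ` {..<k})"
    by (intro bij_betw_subset[OF w]) auto
  show "finite {x \<in> Field r. \<not> isl (w x)}" using bij_betw_finite[OF bij] by simp
  show "card {x \<in> Field r. \<not> isl (w x)} = k"
    using bij_betw_same_card[OF bij] by (simp add: card_image)
qed

text \<open>As tails go to tails and left points to left points, the bijection restricts to one from
  the disjoint union of the tails onto the tail of \<beta>. Counting both sides gives the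
  sum.\<close>

lemma tail_lengths_add_up:
  assumes lim: "\<And>i. i \<in> A \<Longrightarrow> limit_or_zero (\<gamma> i)"
    and eq: "\<And>i. i \<in> A \<Longrightarrow> \<alpha> i =o ord_sum (\<gamma> i) (natLeq_on (n i))" "\<beta> =o ord_sum \<delta> (natLeq_on m)"
    and \<gamma>: "\<And>i. i \<in> A \<Longrightarrow> \<delta> =o \<gamma> i"
    and pos: "\<And>i. i \<in> A \<Longrightarrow> n i > 0"
    and g: "\<And>i. i \<in> A \<Longrightarrow> compat (\<alpha> i) \<beta> (g i)"
      "bij_betw (\<lambda>(i, x). g i x) (Sigma A (\<lambda>i. Field (\<alpha> i))) (Field \<beta>)"
  shows "finite A \<and> (\<Sum>i \<in> A. n i) = m"
proof -
  obtain v where v: "iso \<beta> (ord_sum \<delta> (natLeq_on m)) v" using eq(2) by (auto simp: ordIso_def)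
  have "\<forall>i \<in> A. \<exists>u. iso (\<alpha> i) (ord_sum (\<gamma> i) (natLeq_on (n i))) u"
    using eq(1) by (auto simp: ordIso_def)
  then obtain u where u: "\<And>i. i \<in> A \<Longrightarrow> iso (\<alpha> i) (ord_sum (\<gamma> i) (natLeq_on (n i))) (u i)"
    by metis
  define T where "T = (\<lambda>i. {x \<in> Field (\<alpha> i). \<not> isl (u i x)})"
  define U where "U = {x \<in> Field \<beta>. \<not> isl (v x)}"
  have iff: "isl (v (g i x)) \<longleftrightarrow> isl (u i x)" if i: "i \<in> A" and x: "x \<in> Field (\<alpha> i)" for i x
  proof -
    let ?w = "inv_into (Field (\<alpha> i)) (u i)"
    \<comment> \<open>The map \<open>g i\<close> is conjugated by the two isomorphisms, so that it
      acts between orders in the form required by \<open>compat_preserves_tails\<close>.\<close>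
    define h where "h = v \<circ> g i \<circ> ?w"
    have bu: "bij_betw (u i) (Field (\<alpha> i)) (Field (ord_sum (\<gamma> i) (natLeq_on (n i))))"
      using u[OF i] by (simp add: iso_def)
    have "compat (ord_sum (\<gamma> i) (natLeq_on (n i))) (ord_sum \<delta> (natLeq_on m)) h"
      using iso_backward[OF _ u[OF i]] g(1)[OF i] iso_forward[OF _ v] by (auto simp: compat_def h_def)
    moreover have "inj_on h (Field (ord_sum (\<gamma> i) (natLeq_on (n i))))"
    proof -
      have "inj_on (g i) (Field (\<alpha> i))" using g(2) i by (fastforce simp: bij_betw_def inj_on_def)
      moreover have "g i ` Field (\<alpha> i) \<subseteq> Field \<beta>" using compat_in_Field[OF g(1)[OF i]] by blast
      ultimately have "inj_on (v \<circ> g i) (Field (\<alpha> i))"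
        using comp_inj_on inj_on_subset[OF iso_imp_inj_on[OF v]] by blast
      then show ?thesis
        unfolding h_def using bij_betw_inv_into[OF bu]
        by (auto simp only: bij_betw_def intro: comp_inj_on[where g = "v \<circ> g i"])
    qed
    moreover have "u i x \<in> Field (ord_sum (\<gamma> i) (natLeq_on (n i)))" using bij_betwE[OF bu] x by blast
    ultimately have "isl (h (u i x)) \<longleftrightarrow> isl (u i x)"
      using compat_preserves_tails[OF lim[OF i] \<gamma>[OF i]] by blast
    moreover have "?w (u i x) = x" using bij_betw_inv_into_left[OF bu x] .
    ultimately show ?thesis by (simp add: h_def)
  qed
  have "inj_on (\<lambda>(i, x). g i x) (Sigma A T)"
    by (rule inj_on_subset[OF bij_betw_imp_inj_on[OF g(2)]]) (auto simp: T_def)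
  moreover have "(\<lambda>(i, x). g i x) ` Sigma A T = U"
  proof
    show "(\<lambda>(i, x). g i x) ` Sigma A T \<subseteq> U"
      using iff compat_in_Field[OF g(1)] by (auto simp: T_def U_def)
    show "U \<subseteq> (\<lambda>(i, x). g i x) ` Sigma A T"
    proof
      fix y assume y: "y \<in> U"
      then obtain i x where "i \<in> A" "x \<in> Field (\<alpha> i)" "y = g i x"
        using bij_betw_imp_surj_on[OF g(2)] by (force simp: U_def)
      then show "y \<in> (\<lambda>(i, x). g i x) ` Sigma A T"
        using y iff by (intro image_eqI[of _ _ "(i, x)"]) (auto simp: T_def U_def)
    qed
  qed
  ultimately have bij: "bij_betw (\<lambda>(i, x). g i x) (Sigma A T) U" by (rule bij_betw_imageI)
  have U: "finite U" "card U = m" using card_tail[OF v] by (auto simp: U_def)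
  have T: "finite (T i)" "card (T i) = n i" if "i \<in> A" for i
    using card_tail[OF u[OF that]] by (auto simp: T_def)
  have finS: "finite (Sigma A T)" using bij_betw_finite[OF bij] U by simp
  \<comment> \<open>Positive lengths make every tail nonempty, so \<open>A\<close> is covered by the
    projection of a finite set and is itself finite.\<close>
  have "T i \<noteq> {}" if "i \<in> A" for i using T(2)[OF that] pos[OF that] by auto
  then have "A \<subseteq> fst ` Sigma A T" by force
  then have A: "finite A" using finS finite_imageI finite_subset by blast
  have "m = card (Sigma A T)" using bij_betw_same_card[OF bij] U by simp
  also have "\<dots> = (\<Sum>i \<in> A. n i)" using A T by (simp add: card_SigmaI)
  finally show ?thesis using A by simp
qed

text \<open>The hypothesis on finite classes is the negation of (A). It makes \<open>f\<close>
  injective off the top set \<open>R\<close>, so the failure of injectivity sits inside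
  \<open>R\<close>, and \<open>f\<close> restricted to \<open>R\<close> is the witness for
  (B).\<close>

lemma not_reversible_imp:
  fixes I :: "'i set" and \<alpha> \<gamma> :: "'i \<Rightarrow> 'a rel" and n :: "'i \<Rightarrow> nat"
  assumes wo: "\<And>i. i \<in> I \<Longrightarrow> Well_order (\<alpha> i)"
    and ne: "\<And>i. i \<in> I \<Longrightarrow> Field (\<alpha> i) \<noteq> {}"
    and lim: "\<And>i. i \<in> I \<Longrightarrow> limit_or_zero (\<gamma> i)"
    and eq: "\<And>i. i \<in> I \<Longrightarrow> \<alpha> i =o ord_sum (\<gamma> i) (natLeq_on (n i))"
    and nrev: "\<not> reversible (disjoint_union I \<alpha>)"
    and fin: "\<And>i \<beta> :: 'a rel. i \<in> I \<Longrightarrow> \<beta> \<le>o \<gamma> i \<Longrightarrow> finite (same_ordinal I \<alpha> \<beta>)"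
  shows "\<exists>\<delta> :: 'a rel. limit_or_zero \<delta> \<and>
    infinite (same_ordinal I \<gamma> \<delta> - same_ordinal I \<alpha> \<delta>) \<and>
    \<not> reversible_sequence (same_ordinal I \<gamma> \<delta> - same_ordinal I \<alpha> \<delta>) n"
proof -
  obtain F where F: "bij_betw F (Field (disjoint_union I \<alpha>)) (Field (disjoint_union I \<alpha>))"
    "order_preserving (disjoint_union I \<alpha>) F" "\<not> order_automorphism (disjoint_union I \<alpha>) F"
    using nrev by (auto simp: reversible_def)
  obtain f g where f: "f ` I = I" "\<not> inj_on f I"
    and g: "\<And>i. i \<in> I \<Longrightarrow> compat (\<alpha> i) (\<alpha> (f i)) (g i)"
      "\<And>i. i \<in> I \<Longrightarrow> inj_on (g i) (Field (\<alpha> i))"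
      "\<And>j. j \<in> I \<Longrightarrow>
        bij_betw (\<lambda>(i, x). g i x) (Sigma {i \<in> I. f i = j} (\<lambda>i. Field (\<alpha> i))) (Field (\<alpha> j))"
    using bijective_preserving_components[OF wo ne F] by blast
  have fI: "f i \<in> I" if "i \<in> I" for i using f(1) that by blast
  have le: "\<alpha> i \<le>o \<alpha> (f i)" if "i \<in> I" for i
    using compat_inj_imp_ordLeq[OF wo wo g(1,2)] fI that by blast
  have w\<gamma>: "Well_order (\<gamma> i)" if "i \<in> I" for i using lim[OF that] by (simp add: limit_or_zero_def)
  have \<gamma>_le: "\<gamma> i \<le>o \<alpha> i" if "i \<in> I" for i
    using ordLeq_ordIso_trans[OF ordLeq_ord_sum[OF w\<gamma>[OF that] natLeq_on_Well_order]
        ordIso_symmetric[OF eq[OF that]]] .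
  have \<gamma>_leI: "\<delta> \<le>o \<gamma> i" if "i \<in> I" "limit_or_zero \<delta>" "\<delta> \<le>o \<alpha> i" for i and \<delta> :: "'a rel"
    using limit_ordLeq_ord_sumD[OF that(2) w\<gamma>[OF that(1)] ordLeq_ordIso_trans[OF that(3) eq[OF that(1)]]] .
  define R where "R = {i \<in> I. \<forall>k \<in> I. \<gamma> k <o \<alpha> i}"
  have RI: "R \<subseteq> I" by (auto simp: R_def)
  have small: "\<exists>k \<in> I. \<alpha> i \<le>o \<gamma> k" if "i \<in> I" "i \<notin> R" for i
    using that wo w\<gamma> not_ordLess_iff_ordLeq unfolding R_def by blast
  have cls: "inj_on f (same_ordinal I \<alpha> \<beta>) \<and>
      (\<forall>i \<in> I. f i \<in> same_ordinal I \<alpha> \<beta> \<longleftrightarrow> i \<in> same_ordinal I \<alpha> \<beta>)"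
    if "\<exists>k \<in> I. \<beta> \<le>o \<gamma> k" for \<beta> :: "'a rel"
  proof (rule surj_bijective_on_finite_classes[where Q = "\<lambda>\<beta>. \<exists>k \<in> I. \<beta> \<le>o \<gamma> k"])
    show "\<exists>k \<in> I. \<alpha> i \<le>o \<gamma> k" if "\<exists>k \<in> I. \<beta> \<le>o \<gamma> k" "i \<in> I" "\<alpha> i <o \<beta>" for \<beta> :: "'a rel" and i
      using that ordLess_imp_ordLeq ordLeq_transitive by blast
  qed (use wo f(1) le fin that in blast)+
  have self: "i \<in> same_ordinal I \<alpha> (\<alpha> i)" if "i \<in> I" for i
    using that ordIso_reflexive[OF wo[OF that]] by (simp add: same_ordinal_def)
  have fR: "f i \<in> R \<longleftrightarrow> i \<in> R" if i: "i \<in> I" for i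
  proof
    assume "i \<in> R"
    then show "f i \<in> R" using fI[OF i] le[OF i] ordLess_ordLeq_trans unfolding R_def by blast
  next
    assume fiR: "f i \<in> R"
    show "i \<in> R"
    proof (rule ccontr)
      assume "i \<notin> R"
      then obtain k where k: "k \<in> I" "\<alpha> i \<le>o \<gamma> k" using small i by blast
      then have "f i \<in> same_ordinal I \<alpha> (\<alpha> i)" using cls self i by blast
      then have "\<alpha> (f i) \<le>o \<gamma> k" using k(2) ordIso_ordLeq_trans by (auto simp: same_ordinal_def)
      moreover have "\<gamma> k <o \<alpha> (f i)" using fiR k(1) by (auto simp: R_def)
      ultimately show False using not_ordLess_ordLeq by blast
    qed
  qed
  have fib: "{i \<in> I. f i = j} = {i \<in> R. f i = j}" if "j \<in> R" for j
    using that fR RI by auto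
  \<comment> \<open>Two indices identified by \<open>f\<close> must both lie in \<open>R\<close>: if
    \<open>i\<close> were outside, \<open>k\<close> would belong to the class of
    \<open>\<alpha> i\<close>, on which \<open>f\<close> is injective.\<close>
  obtain i k where ik: "i \<in> I" "k \<in> I" "i \<noteq> k" "f i = f k"
    using f(2) by (auto simp: inj_on_def)
  have "i \<in> R"
  proof (rule ccontr)
    assume "i \<notin> R"
    with small ik(1) have c: "\<exists>k \<in> I. \<alpha> i \<le>o \<gamma> k" by blast
    have "f i \<in> same_ordinal I \<alpha> (\<alpha> i)" using cls[OF c] self[OF ik(1)] ik(1) by blast
    then have "f k \<in> same_ordinal I \<alpha> (\<alpha> i)" by (simp only: ik(4))
    then have "k \<in> same_ordinal I \<alpha> (\<alpha> i)" using cls[OF c] ik(2) by blast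
    then show False
      using inj_onD[OF conjunct1[OF cls[OF c]] ik(4) self[OF ik(1)]] ik(3) by blast
  qed
  then have "k \<in> R" using fR ik by metis
  have ninj: "\<not> inj_on f R" using \<open>i \<in> R\<close> \<open>k \<in> R\<close> ik(3,4) by (auto dest: inj_onD)
  have surj: "f ` R = R"
  proof
    show "f ` R \<subseteq> R" using fR RI by blast
    show "R \<subseteq> f ` R"
    proof
      fix j assume j: "j \<in> R"
      then obtain l where "l \<in> I" "j = f l" using f(1) RI by blast
      then show "j \<in> f ` R" using fR j by blast
    qed
  qed
  \<comment> \<open>All indices in \<open>R\<close> share this limit part: for \<open>j\<close> in
    \<open>R\<close>, \<open>\<gamma> j\<close> is below \<open>\<alpha> i\<close> and
    \<open>\<gamma> i\<close> is below \<open>\<alpha> j\<close>, and \<open>\<gamma>_leI\<close>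
    strips the tails from both comparisons.\<close>
  define \<delta> where "\<delta> = \<gamma> i"
  have iI: "i \<in> I" using ik(1) .
  have \<gamma>_iso: "\<gamma> j =o \<delta>" if "j \<in> R" for j
    using that \<open>i \<in> R\<close> \<gamma>_leI lim ordLess_imp_ordLeq ordIso_iff_ordLeq unfolding R_def \<delta>_def by blast
  have R: "R = same_ordinal I \<gamma> \<delta> - same_ordinal I \<alpha> \<delta>"
  proof (intro equalityI subsetI)
    fix j assume j: "j \<in> R"
    then have "\<delta> <o \<alpha> j" using iI by (auto simp: R_def \<delta>_def)
    then have "\<not> \<alpha> j =o \<delta>" using ordIso_symmetric not_ordLess_ordIso by blast
    then show "j \<in> same_ordinal I \<gamma> \<delta> - same_ordinal I \<alpha> \<delta>"
      using \<gamma>_iso[OF j] j RI by (auto simp: same_ordinal_def)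
  next
    fix j assume "j \<in> same_ordinal I \<gamma> \<delta> - same_ordinal I \<alpha> \<delta>"
    then have j: "j \<in> I" "\<gamma> j =o \<delta>" "\<not> \<alpha> j =o \<delta>" by (auto simp: same_ordinal_def)
    have "\<delta> \<le>o \<alpha> j" using ordIso_ordLeq_trans[OF ordIso_symmetric[OF j(2)] \<gamma>_le[OF j(1)]] .
    then have less: "\<delta> <o \<alpha> j" using j(3) ordLeq_iff_ordLess_or_ordIso ordIso_symmetric by blast
    have "\<gamma> l <o \<alpha> j" if l: "l \<in> I" for l
    proof -
      have "\<gamma> l \<le>o \<alpha> i" using \<open>i \<in> R\<close> l ordLess_imp_ordLeq by (auto simp: R_def)
      then have "\<gamma> l \<le>o \<delta>" unfolding \<delta>_def using \<gamma>_leI[OF iI lim[OF l]] by blast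
      then show ?thesis using less ordLeq_ordLess_trans by blast
    qed
    then show "j \<in> R" using j(1) by (simp add: R_def)
  qed
  \<comment> \<open>With an empty tail \<open>\<alpha> j\<close> would equal
    \<open>\<gamma> j\<close>, while membership in \<open>R\<close> puts \<open>\<gamma> j\<close>
    strictly below \<open>\<alpha> j\<close>.\<close>
  have pos: "n j > 0" if "j \<in> R" for j
  proof (rule ccontr)
    assume "\<not> n j > 0"
    then have "\<alpha> j =o ord_sum (\<gamma> j) (natLeq_on 0)" using eq[of j] that RI by auto
    then have "\<alpha> j =o \<gamma> j"
      using ordIso_transitive ordIso_symmetric[OF ordIso_ord_sum_zero[OF w\<gamma>]] that RI by blast
    moreover have "\<gamma> j <o \<alpha> j" using that by (auto simp: R_def)
    ultimately show False using ordIso_symmetric not_ordLess_ordIso by blast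
  qed
  have sums: "finite {i \<in> R. f i = j} \<and> (\<Sum>i \<in> {i \<in> R. f i = j}. n i) = n j" if j: "j \<in> R" for j
  proof (rule tail_lengths_add_up[where \<alpha> = \<alpha> and \<gamma> = \<gamma> and \<beta> = "\<alpha> j" and \<delta> = "\<gamma> j" and g = g])
    show "bij_betw (\<lambda>(i, x). g i x) (Sigma {i \<in> R. f i = j} (\<lambda>i. Field (\<alpha> i))) (Field (\<alpha> j))"
      using g(3)[of j] fib[OF j] j RI by auto
    show "\<gamma> j =o \<gamma> l" if "l \<in> {i \<in> R. f i = j}" for l
      using \<gamma>_iso[OF j] \<gamma>_iso[of l] that ordIso_symmetric ordIso_transitive by blast
    show "compat (\<alpha> l) (\<alpha> j) (g l)" if "l \<in> {i \<in> R. f i = j}" for l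
      using g(1)[of l] that RI by auto
  qed (use lim eq pos j RI in auto)
  show ?thesis
  proof (intro exI conjI)
    show "limit_or_zero \<delta>" using lim[OF iI] by (simp add: \<delta>_def)
    \<comment> \<open>On a finite set the surjection \<open>f\<close> would be injective.\<close>
    show "infinite (same_ordinal I \<gamma> \<delta> - same_ordinal I \<alpha> \<delta>)"
      unfolding R[symmetric] using ninj surj eq_card_imp_inj_on by metis
    show "\<not> reversible_sequence (same_ordinal I \<gamma> \<delta> - same_ordinal I \<alpha> \<delta>) n"
      unfolding R[symmetric] reversible_sequence_def
      using surj ninj sums by (auto simp: bij_betw_def)
  qed
qed

theorem theorem2p3:
  fixes I :: "'i set"
    and \<alpha> \<gamma> :: "'i \<Rightarrow> 'a rel"
    and n :: "'i \<Rightarrow> nat"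
  assumes "I \<noteq> {}"
    and "\<And>i. i \<in> I \<Longrightarrow> Well_order (\<alpha> i)"
    and "\<And>i. i \<in> I \<Longrightarrow> Field (\<alpha> i) \<noteq> {}"
    and "\<And>i. i \<in> I \<Longrightarrow> limit_or_zero (\<gamma> i)"
    and "\<And>i. i \<in> I \<Longrightarrow> \<alpha> i =o ord_sum (\<gamma> i) (natLeq_on (n i))"
  shows "\<not> reversible (disjoint_union I \<alpha>) \<longleftrightarrow>
    (\<exists>i \<in> I. \<exists>\<beta> :: 'a rel. Well_order \<beta> \<and> \<beta> \<le>o \<gamma> i \<and> infinite (same_ordinal I \<alpha> \<beta>)) \<or>
    (\<exists>\<delta> :: 'a rel. limit_or_zero \<delta> \<and>
       infinite (same_ordinal I \<gamma> \<delta> - same_ordinal I \<alpha> \<delta>) \<and>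
       \<not> reversible_sequence (same_ordinal I \<gamma> \<delta> - same_ordinal I \<alpha> \<delta>) n)"
  (is "_ \<longleftrightarrow> ?A \<or> ?B")
proof
  assume nrev: "\<not> reversible (disjoint_union I \<alpha>)"
  show "?A \<or> ?B"
  proof (rule disjCI)
    assume "\<not> ?B"
    show ?A
    proof (rule ccontr)
      assume "\<not> ?A"
      then have fin: "finite (same_ordinal I \<alpha> \<beta>)" if "i \<in> I" "\<beta> \<le>o \<gamma> i" for i and \<beta> :: "'a rel"
        using that ordLeq_Well_order_simp by blast
      have ?B by (rule not_reversible_imp) (fact assms(2-5) nrev fin)+
      with \<open>\<not> ?B\<close> show False by (rule notE)
    qed
  qed
next
  assume "?A \<or> ?B"
  then show "\<not> reversible (disjoint_union I \<alpha>)"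
  proof
    assume ?A
    then obtain k and \<beta> :: "'a rel" where k: "k \<in> I"
      and \<beta>: "\<beta> \<le>o \<gamma> k" "infinite (same_ordinal I \<alpha> \<beta>)" by blast
    show ?thesis
      by (rule not_reversible_if_infinite_class) (fact assms(2,3) assms(4,5)[OF k] k \<beta>)+
  next
    assume ?B
    then obtain \<delta> :: "'a rel" where \<delta>: "limit_or_zero \<delta>"
      "\<not> reversible_sequence (same_ordinal I \<gamma> \<delta> - same_ordinal I \<alpha> \<delta>) n" by blast
    show ?thesis
      by (rule not_reversible_if_tail_sequence) (fact assms(2,3,5) \<delta> Diff_subset)+
  qed
qed

end
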